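(* Let $G$ be a $k$-regular graph of order $2n$ (that is, with $2n$ vertices). If $G$ has $k$ pairwise (edge-)disjoint perfect matchings and $\alpha(G)\geq \lceil \frac{n}{2}\rceil$, then $\tau_{d}(G)=kd$ for every integer $d$ with $1\leq d\leq n$.
   Context: All graphs are simple, finite and undirected. A matching of a graph $G$ is a set of edges no two of which share an endpoint; a maximum matching is a matching of largest cardinality, and this cardinality is denoted $\nu(G)$. A matching is perfect if it covers all vertices of $G$. For an integer $d$ with $1\leq d\leq \nu(G)$, a $d$-transversal set of $G$ is a set $T\subseteq E(G)$ such that $|T\cap M|\geq d$ for every maximum matching $M$ of $G$; $\tau_d(G)$ denotes the minimum cardinality of a $d$-transversal set of $G$. A stable set is a set of pairwise non-adjacent vertices, and $\alpha(G)$ is the maximum cardinality of a stable set of $G$. $\lceil x\rceil$ is the smallest integer not less than $x$. *)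

theory Defs
  imports Complex_Main "HOL-Library.Disjoint_Sets"
begin

text \<open>A graph is a vertex set \<open>V\<close> with an edge set \<open>E\<close> of two-element subsets of \<open>V\<close>.\<close>

definition finite_simple_graph :: "'v set \<Rightarrow> 'v set set \<Rightarrow> bool" where
  "finite_simple_graph V E \<longleftrightarrow> finite V \<and> (\<forall>e\<in>E. e \<subseteq> V \<and> card e = 2)"

definition degree :: "'v set set \<Rightarrow> 'v \<Rightarrow> nat" where
  "degree E v = card {e \<in> E. v \<in> e}"

definition regular :: "nat \<Rightarrow> 'v set \<Rightarrow> 'v set set \<Rightarrow> bool" where
  "regular k V E \<longleftrightarrow> (\<forall>v\<in>V. degree E v = k)"

definition matching :: "'v set set \<Rightarrow> 'v set set \<Rightarrow> bool" where
  "matching E M \<longleftrightarrow> M \<subseteq> E \<and> disjoint M"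

definition matching_number :: "'v set set \<Rightarrow> nat" where
  "matching_number E = Max {card M | M. matching E M}"

definition maximum_matching :: "'v set set \<Rightarrow> 'v set set \<Rightarrow> bool" where
  "maximum_matching E M \<longleftrightarrow> matching E M \<and> card M = matching_number E"

definition perfect_matching :: "'v set \<Rightarrow> 'v set set \<Rightarrow> 'v set set \<Rightarrow> bool" where
  "perfect_matching V E M \<longleftrightarrow> matching E M \<and> \<Union>M = V"

definition stable_set :: "'v set \<Rightarrow> 'v set set \<Rightarrow> 'v set \<Rightarrow> bool" where
  "stable_set V E S \<longleftrightarrow> S \<subseteq> V \<and> (\<forall>u\<in>S. \<forall>v\<in>S. {u, v} \<notin> E)"

definition stability_number :: "'v set \<Rightarrow> 'v set set \<Rightarrow> nat" where
  "stability_number V E = Max {card S | S. stable_set V E S}"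

definition transversal_set :: "'v set set \<Rightarrow> nat \<Rightarrow> 'v set set \<Rightarrow> bool" where
  "transversal_set E d T \<longleftrightarrow> T \<subseteq> E \<and> (\<forall>M. maximum_matching E M \<longrightarrow> card (T \<inter> M) \<ge> d)"

text \<open>The notion is meant for \<open>1 \<le> d \<le> matching_number E\<close>. For larger \<open>d\<close> there is no
  \<open>d\<close>-transversal set (not even \<open>E\<close>), and the value is set to \<open>0\<close> by convention.\<close>

definition transversal_number :: "'v set set \<Rightarrow> nat \<Rightarrow> nat" where
  "transversal_number E d =
     (if d \<le> matching_number E then Min {card T | T. transversal_set E d T} else 0)"

end

theory Submission
  imports Defs
begin

text \<open>
  The lower bound \<open>\<tau>\<^sub>d \<ge> k d\<close> holds because a \<open>d\<close>-transversal set meets each of the \<open>k\<close> disjoint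
  perfect matchings in at least \<open>d\<close> edges (\<open>transversal_card_ge\<close>).

  For the upper bound, let \<open>S\<close> be a stable set. The edges meeting \<open>S\<close> split into the stars of the
  vertices of \<open>S\<close>, so any \<open>c\<close>-regular spanning subgraph has exactly \<open>c |S|\<close> of them
  (\<open>card_incident_edges\<close>), and by the handshake lemma it has \<open>c n - c |S|\<close> edges avoiding \<open>S\<close>.
  With \<open>c = k\<close> this counts edges of the whole graph, and with \<open>c = 1\<close> it counts edges of a perfect
  matching. If \<open>k \<ge> 1\<close>, then there is a perfect matching, so every maximum matching is
  perfect. Hence the edges meeting \<open>S\<close> form a \<open>d\<close>-transversal set of size \<open>k d\<close> for \<open>d = |S|\<close>, and the edges avoiding \<open>S\<close>
  form one for \<open>d = n - |S|\<close>. Subsets of stable sets are stable, so \<open>|S|\<close> takes every value up to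
  \<open>\<lceil>n/2\<rceil>\<close>; the first construction then serves \<open>d \<le> \<lceil>n/2\<rceil>\<close> and the second serves the larger \<open>d\<close>.
\<close>

section \<open>Counting edges of regular graphs\<close>

definition incident_edges :: "'v set set \<Rightarrow> 'v set \<Rightarrow> 'v set set" where
  "incident_edges F S = {e \<in> F. e \<inter> S \<noteq> {}}"

lemma finite_simple_graph_finite_edges:
  assumes "finite_simple_graph V E"
  shows "finite E"
proof -
  have "E \<subseteq> Pow V" "finite V"
    using assms by (auto simp: finite_simple_graph_def)
  then show ?thesis
    by (meson finite_Pow_iff finite_subset)
qed

lemma finite_simple_graph_subgraph:
  assumes "finite_simple_graph V E" "F \<subseteq> E"
  shows "finite_simple_graph V F"
  using assms by (auto simp: finite_simple_graph_def)

lemma handshake_regular: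
  assumes "finite_simple_graph V E" "regular k V E"
  shows "2 * card E = k * card V"
proof -
  have "{v \<in> V. v \<in> e} = e" if "e \<in> E" for e
    using assms(1) that by (auto simp: finite_simple_graph_def)
  then have "(\<Sum>v\<in>V. card {e \<in> E. v \<in> e}) = 2 * card E"
    using assms(1) finite_simple_graph_finite_edges[OF assms(1)]
    by (intro sum_multicount) (auto simp: finite_simple_graph_def)
  then show ?thesis
    using assms(2) by (simp add: regular_def degree_def mult.commute)
qed

text \<open>The graph \<open>F\<close> whose degrees are counted may be smaller than the graph \<open>E\<close> in which \<open>S\<close> is
  stable, so that the lemma applies to a perfect matching as well as to the whole graph.\<close>

lemma card_incident_edges:
  assumes graph: "finite_simple_graph V E" and stable: "stable_set V E S"
    and "F \<subseteq> E" and reg: "regular c V F"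
  shows "card (incident_edges F S) = c * card S"
proof -
  have "S \<subseteq> V" and "finite V"
    using graph stable by (auto simp: stable_set_def finite_simple_graph_def)
  have "finite F"
    using finite_simple_graph_finite_edges[OF graph] \<open>F \<subseteq> E\<close> by (rule rev_finite_subset)
  \<comment> \<open>An edge in the stars of two vertices of \<open>S\<close> would join them, against stability.\<close>
  have stars_disjoint: "{e \<in> F. u \<in> e} \<inter> {e \<in> F. v \<in> e} = {}"
    if "u \<in> S" "v \<in> S" "u \<noteq> v" for u v
  proof -
    have False if e: "e \<in> F" "u \<in> e" "v \<in> e" for e
    proof -
      have "card e = 2" "e \<in> E"
        using graph \<open>F \<subseteq> E\<close> e by (auto simp: finite_simple_graph_def)
      then have "e = {u, v}"
        using e \<open>u \<noteq> v\<close> by (auto simp: card_2_iff)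
      then show False
        using stable \<open>e \<in> E\<close> \<open>u \<in> S\<close> \<open>v \<in> S\<close> by (auto simp: stable_set_def)
    qed
    then show ?thesis
      by blast
  qed
  have "incident_edges F S = (\<Union>v\<in>S. {e \<in> F. v \<in> e})"
    by (auto simp: incident_edges_def)
  also have "card \<dots> = (\<Sum>v\<in>S. card {e \<in> F. v \<in> e})"
    using stars_disjoint \<open>finite F\<close> finite_subset[OF \<open>S \<subseteq> V\<close> \<open>finite V\<close>]
    by (intro card_UN_disjoint) auto
  also have "\<dots> = (\<Sum>v\<in>S. c)"
    using reg \<open>S \<subseteq> V\<close> by (intro sum.cong) (auto simp: regular_def degree_def)
  finally show ?thesis
    by simp
qed

section \<open>Perfect and maximum matchings\<close>

lemma card_Union_matching:
  assumes "finite_simple_graph V E" "matching E M"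
  shows "card (\<Union>M) = 2 * card M"
proof -
  have edges: "e \<subseteq> V \<and> finite V \<and> card e = 2" if "e \<in> M" for e
    using assms that by (auto simp: finite_simple_graph_def matching_def)
  have "card (\<Union>M) = sum card M"
    using assms(2) edges
    by (intro card_Union_disjoint) (auto simp: matching_def disjoint_def pairwise_def disjnt_def
        intro: finite_subset)
  also have "\<dots> = (\<Sum>e\<in>M. 2)"
    using edges by (intro sum.cong) auto
  finally show ?thesis
    by simp
qed

lemma perfect_matching_regular:
  assumes "perfect_matching V E M"
  shows "regular 1 V M"
  unfolding regular_def degree_def
proof
  fix v assume "v \<in> V"
  then obtain e where e: "e \<in> M" "v \<in> e"
    using assms by (auto simp: perfect_matching_def)
  then have "{e \<in> M. v \<in> e} = {e}"
    using assms by (auto simp: perfect_matching_def matching_def disjoint_def pairwise_def disjnt_def)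
  then show "card {e \<in> M. v \<in> e} = 1"
    by simp
qed

lemma finite_matching_cards:
  assumes "finite_simple_graph V E"
  shows "finite {card M | M. matching E M}"
  using finite_simple_graph_finite_edges[OF assms]
  by (intro finite_subset[OF _ finite_atMost[of "card E"]]) (auto simp: matching_def card_mono)

lemma matching_number_perfect:
  assumes graph: "finite_simple_graph V E" and card_V: "card V = 2 * n"
    and perfect: "perfect_matching V E P"
  shows "matching_number E = n"
proof -
  have le: "card M \<le> n" if "matching E M" for M
  proof -
    have "\<Union>M \<subseteq> V" "finite V"
      using graph that by (auto simp: finite_simple_graph_def matching_def)
    then have "card (\<Union>M) \<le> card V"
      by (simp add: card_mono)
    then show ?thesis
      using card_Union_matching[OF graph that] card_V by simp
  qed
  have "matching E P" "card P = n"
    using perfect card_Union_matching[OF graph, of P] card_V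
    by (auto simp: perfect_matching_def)
  then show ?thesis
    unfolding matching_number_def
    using finite_matching_cards[OF graph] le by (intro Max_eqI) auto
qed

lemma maximum_matching_iff_perfect:
  assumes graph: "finite_simple_graph V E" and card_V: "card V = 2 * n"
    and perfect: "perfect_matching V E P"
  shows "maximum_matching E M \<longleftrightarrow> perfect_matching V E M"
proof -
  have "card M = n \<longleftrightarrow> \<Union>M = V" if M: "matching E M"
  proof -
    have "\<Union>M \<subseteq> V" "finite V"
      using graph M by (auto simp: finite_simple_graph_def matching_def)
    then have "\<Union>M = V \<longleftrightarrow> card (\<Union>M) = card V"
      using card_subset_eq by metis
    then show ?thesis
      using card_Union_matching[OF graph M] card_V by auto
  qed
  then show ?thesis
    using matching_number_perfect[OF graph card_V perfect]
    by (auto simp: maximum_matching_def perfect_matching_def)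
qed

section \<open>Transversal sets\<close>

lemma transversal_card_ge:
  assumes "finite E" and T: "transversal_set E d T"
    and max: "\<And>i. i < k \<Longrightarrow> maximum_matching E (P i)"
    and disj: "disjoint_family_on P {..<k}"
  shows "k * d \<le> card T"
proof -
  have "finite T"
    using T \<open>finite E\<close> by (auto simp: transversal_set_def intro: finite_subset)
  have "k * d = (\<Sum>i<k. d)"
    by simp
  also have "\<dots> \<le> (\<Sum>i<k. card (T \<inter> P i))"
    using T max by (intro sum_mono) (auto simp: transversal_set_def)
  also have "\<dots> = card (\<Union>i<k. T \<inter> P i)"
    using disj \<open>finite T\<close>
    by (intro card_UN_disjoint[symmetric]) (auto simp: disjoint_family_on_def)
  also have "\<dots> \<le> card T"
    using \<open>finite T\<close> by (intro card_mono) auto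
  finally show ?thesis .
qed

lemma transversal_number_eqI:
  assumes "finite E" "d \<le> matching_number E"
    and T: "transversal_set E d T" "card T = m"
    and lower: "\<And>T. transversal_set E d T \<Longrightarrow> m \<le> card T"
  shows "transversal_number E d = m"
proof -
  have "finite {card T | T. transversal_set E d T}"
    using \<open>finite E\<close> by (intro finite_subset[OF _ finite_atMost[of "card E"]])
      (auto simp: transversal_set_def card_mono)
  then have "Min {card T | T. transversal_set E d T} = m"
    using T lower by (intro Min_eqI) auto
  then show ?thesis
    using assms(2) by (simp add: transversal_number_def)
qed

lemma exists_stable_set_card:
  assumes graph: "finite_simple_graph V E" and "m \<le> stability_number V E"
  obtains S where "stable_set V E S" "card S = m"
proof -
  let ?C = "{card S | S. stable_set V E S}"
  have "finite V"
    using graph by (simp add: finite_simple_graph_def)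
  then have "finite ?C"
    by (intro finite_subset[OF _ finite_atMost[of "card V"]]) (auto simp: stable_set_def card_mono)
  moreover have "stable_set V E {}"
    by (simp add: stable_set_def)
  then have "?C \<noteq> {}"
    by blast
  ultimately have "Max ?C \<in> ?C"
    by (rule Max_in)
  then obtain S where S: "stable_set V E S" "card S = stability_number V E"
    by (auto simp: stability_number_def)
  then obtain S' where "S' \<subseteq> S" "card S' = m"
    using assms(2) by (metis obtain_subset_with_card_n)
  moreover from this S have "stable_set V E S'"
    by (auto simp: stable_set_def)
  ultimately show thesis
    using that by blast
qed

text \<open>The witness is the set of edges meeting \<open>S\<close> if \<open>d = |S|\<close>, and the set of edges avoiding \<open>S\<close>
  if \<open>d = n - |S|\<close>. Every perfect matching has exactly \<open>d\<close> edges in it, and the same count with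
  degree \<open>k\<close> in place of degree \<open>1\<close> gives its size \<open>k d\<close>.\<close>

lemma exists_transversal_set_card:
  assumes graph: "finite_simple_graph V E" and card_V: "card V = 2 * n"
    and reg: "regular k V E"
    and maximum: "\<And>M. maximum_matching E M \<Longrightarrow> perfect_matching V E M"
    and stable: "stable_set V E S" and d: "d = card S \<or> d + card S = n"
  obtains T where "transversal_set E d T" "card T = k * d"
proof -
  note fin = finite_simple_graph_finite_edges[OF graph]
  have meeting: "card (incident_edges F S) = c * card S"
    and avoiding: "card (F - incident_edges F S) + c * card S = c * n"
    if "F \<subseteq> E" "regular c V F" for F c
  proof -
    show inc: "card (incident_edges F S) = c * card S"
      using card_incident_edges[OF graph stable that] .
    have "card F = c * n"
      using handshake_regular[OF finite_simple_graph_subgraph[OF graph that(1)] that(2)] card_V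
      by simp
    moreover have "incident_edges F S \<subseteq> F" "finite F"
      using fin that(1) by (auto simp: incident_edges_def intro: finite_subset)
    then have "card F = card (incident_edges F S) + card (F - incident_edges F S)"
      by (metis card_Diff_subset card_mono finite_subset le_add_diff_inverse)
    ultimately show "card (F - incident_edges F S) + c * card S = c * n"
      using inc by simp
  qed
  have M: "M \<subseteq> E" "regular 1 V M" if "maximum_matching E M" for M
    using maximum[OF that] perfect_matching_regular
    by (auto simp: perfect_matching_def matching_def)
  from d show thesis
  proof
    assume d: "d = card S"
    have "incident_edges E S \<inter> M = incident_edges M S" if "M \<subseteq> E" for M
      using that by (auto simp: incident_edges_def)
    moreover have "card (incident_edges M S) = d" if "maximum_matching E M" for M
      using meeting[OF M[OF that]] d by simp
    moreover have "incident_edges E S \<subseteq> E"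
      by (auto simp: incident_edges_def)
    ultimately have "transversal_set E d (incident_edges E S)"
      using M by (auto simp: transversal_set_def)
    then show thesis
      using that meeting[OF subset_refl reg] d by simp
  next
    assume d: "d + card S = n"
    have "(E - incident_edges E S) \<inter> M = M - incident_edges M S" if "M \<subseteq> E" for M
      using that by (auto simp: incident_edges_def)
    moreover have "card (M - incident_edges M S) = d" if "maximum_matching E M" for M
      using avoiding[OF M[OF that]] d by simp
    ultimately have "transversal_set E d (E - incident_edges E S)"
      using M by (auto simp: transversal_set_def)
    moreover have "card (E - incident_edges E S) = k * d"
      using avoiding[OF subset_refl reg] d by (auto simp: distrib_left)
    ultimately show thesis
      using that by blast
  qed
qed

theorem proposition2p3:
  fixes V :: "'v set" and E :: "'v set set" and k n :: nat
  assumes "finite_simple_graph V E"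
    and "card V = 2 * n"
    and "regular k V E"
    and "\<exists>P :: nat \<Rightarrow> 'v set set.
           (\<forall>i<k. perfect_matching V E (P i)) \<and> disjoint_family_on P {..<k}"
    and "int (stability_number V E) \<ge> \<lceil>real n / 2\<rceil>"
  shows "\<forall>d. 1 \<le> d \<and> d \<le> n \<longrightarrow> transversal_number E d = k * d"
proof (intro allI impI)
  fix d assume d: "1 \<le> d \<and> d \<le> n"
  note graph = assms(1) and card_V = assms(2) and reg = assms(3)
  note fin = finite_simple_graph_finite_edges[OF graph]
  obtain P where P: "\<And>i. i < k \<Longrightarrow> perfect_matching V E (P i)" "disjoint_family_on P {..<k}"
    using assms(4) by blast
  show "transversal_number E d = k * d"
  proof (cases "k = 0")
    case True
    \<comment> \<open>Without edges the matching number is \<open>0 < d\<close>, and the convention for such \<open>d\<close> gives \<open>0\<close>.\<close>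
    then have "E = {}"
      using handshake_regular[OF graph reg] fin by simp
    then have "matching_number E = 0"
      by (simp add: matching_number_def matching_def)
    then show ?thesis
      using True d by (simp add: transversal_number_def)
  next
    case False
    then have perfect: "perfect_matching V E (P 0)"
      using P(1) by simp
    note max_iff = maximum_matching_iff_perfect[OF graph card_V perfect]
    define s where "s = (if 2 * d \<le> n + 1 then d else n - d)"
    have "2 * s \<le> n + 1"
      using d by (auto simp: s_def)
    moreover have "real n / 2 \<le> real (stability_number V E)"
      using assms(5) by linarith
    ultimately have "s \<le> stability_number V E"
      by linarith
    then obtain S where S: "stable_set V E S" "card S = s"
      by (rule exists_stable_set_card[OF graph])
    have "d = card S \<or> d + card S = n"
      using S(2) d by (auto simp: s_def)
    then obtain T where T: "transversal_set E d T" "card T = k * d"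
      using exists_transversal_set_card[OF graph card_V reg _ S(1)] max_iff by blast
    show ?thesis
    proof (rule transversal_number_eqI[OF fin _ T])
      show "d \<le> matching_number E"
        using matching_number_perfect[OF graph card_V perfect] d by simp
      show "k * d \<le> card T'" if "transversal_set E d T'" for T'
        using transversal_card_ge[OF fin that _ P(2)] P(1) max_iff by blast
    qed
  qed
qed

end
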